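(* Let $r\geq 1$ be an integer, let $s,\epsilon\in\{0,1\}$, and let $n=4r+2s+\epsilon$. Then there exists a Cayley graph (of a finite group) of diameter two, of degree $d=2n-s+\epsilon$, and of order $\frac12(d+s-\epsilon)^2$.
   Context: For a finite group $\Gamma$ and a generating set $X$ of $\Gamma$ that is unit-free (does not contain the identity) and inverse-closed ($X=X^{-1}$), the Cayley graph $Cay(\Gamma,X)$ is the undirected simple graph with vertex set $\Gamma$ and edge set $\{\{g,h\} : g\in\Gamma,\ g^{-1}h\in X\}$. Its degree is $|X|$ and its order is its number of vertices $|\Gamma|$. The diameter of a graph is the maximum distance between two of its vertices. *)

theory Defs
  imports "HOL-Algebra.Algebra" "Graph_Theory.Graph_Theory"
begin

definition cayley_set :: "('a, 'b) monoid_scheme \<Rightarrow> 'a set \<Rightarrow> bool" where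
  "cayley_set \<Gamma> S \<longleftrightarrow>
     S \<subseteq> carrier \<Gamma> \<and> generate \<Gamma> S = carrier \<Gamma> \<and> \<one>\<^bsub>\<Gamma>\<^esub> \<notin> S \<and> S = set_inv\<^bsub>\<Gamma>\<^esub> S"

(* As usual in Graph_Theory, an undirected simple graph is a symmetric loop-free digraph
   without parallel arcs: the edge {g, h} is the pair of arcs (g, h) and (h, g). *)
definition cayley_graph :: "('a, 'b) monoid_scheme \<Rightarrow> 'a set \<Rightarrow> 'a pair_pre_digraph" where
  "cayley_graph \<Gamma> S =
     \<lparr> pverts = carrier \<Gamma>,
       parcs = {(g, h). g \<in> carrier \<Gamma> \<and> h \<in> carrier \<Gamma> \<and> inv\<^bsub>\<Gamma>\<^esub> g \<otimes>\<^bsub>\<Gamma>\<^esub> h \<in> S} \<rparr>"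

(* The distance is the cost of a shortest walk when every arc costs 1; it is infinite if there
   is no walk. *)
definition graph_diameter :: "('a, 'b) pre_digraph \<Rightarrow> ereal" where
  "graph_diameter G = (SUP u\<in>verts G. SUP v\<in>verts G. wf_digraph.\<mu> G (\<lambda>_. 1) u v)"

lemma pair_graph_cayley_graph:
  assumes "group \<Gamma>" "finite (carrier \<Gamma>)" "cayley_set \<Gamma> S"
  shows "pair_graph (cayley_graph \<Gamma> S)"
proof -
  interpret group \<Gamma> by fact
  have S: "S \<subseteq> carrier \<Gamma>" "\<one>\<^bsub>\<Gamma>\<^esub> \<notin> S" "S = set_inv\<^bsub>\<Gamma>\<^esub> S"
    using assms(3) by (auto simp: cayley_set_def)
  have inv_S: "inv\<^bsub>\<Gamma>\<^esub> x \<in> S" if "x \<in> S" for x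
    using that S(3) by (auto simp: SET_INV_def)
  have sym: "inv\<^bsub>\<Gamma>\<^esub> h \<otimes>\<^bsub>\<Gamma>\<^esub> g \<in> S"
    if "g \<in> carrier \<Gamma>" "h \<in> carrier \<Gamma>" "inv\<^bsub>\<Gamma>\<^esub> g \<otimes>\<^bsub>\<Gamma>\<^esub> h \<in> S" for g h
    using inv_S[OF that(3)] that by (simp add: inv_mult_group)
  have "finite (parcs (cayley_graph \<Gamma> S))"
    by (rule finite_subset[of _ "carrier \<Gamma> \<times> carrier \<Gamma>"])
      (auto simp: cayley_graph_def assms(2))
  then show ?thesis
    using sym S(2) assms(2)
    by unfold_locales
      (auto simp: cayley_graph_def symmetric_def sym_def)
qed

lemma out_degree_cayley_graph:
  assumes "group \<Gamma>" "cayley_set \<Gamma> S" "g \<in> carrier \<Gamma>"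
  shows "out_degree (cayley_graph \<Gamma> S) g = card S"
proof -
  interpret group \<Gamma> by fact
  have S: "S \<subseteq> carrier \<Gamma>"
    using assms(2) by (auto simp: cayley_set_def)
  have "bij_betw (\<lambda>x. (g, g \<otimes>\<^bsub>\<Gamma>\<^esub> x)) S (out_arcs (cayley_graph \<Gamma> S) g)"
  proof (rule bij_betwI[where g = "\<lambda>e. inv\<^bsub>\<Gamma>\<^esub> g \<otimes>\<^bsub>\<Gamma>\<^esub> snd e"])
    show "(\<lambda>x. (g, g \<otimes>\<^bsub>\<Gamma>\<^esub> x)) \<in> S \<rightarrow> out_arcs (cayley_graph \<Gamma> S) g"
      using S assms(3) by (auto simp: out_arcs_def cayley_graph_def subset_iff inv_solve_left' m_assoc[symmetric])
  qed (use S assms(3) in \<open>auto simp: out_arcs_def cayley_graph_def subset_iff m_assoc[symmetric]\<close>)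
  then show ?thesis
    by (simp add: out_degree_def bij_betw_same_card)
qed

end

theory Submission
  imports Defs
begin

text \<open>
  Put \<open>h = 2 r + s\<close>, so that \<open>n = 2 h + \<epsilon>\<close>, and let \<open>t\<close> be the coordinate swap in the wreath product
  of \<open>\<int>/n\<close> with \<open>\<langle>t\<rangle>\<close>, a group of order \<open>2 n\<^sup>2\<close>. The generators are the translations \<open>\<plusminus>(x, h - x)\<close>
  with \<open>0 \<le> x \<le> r\<close> and the elements \<open>b t\<close>, where \<open>b\<close> is \<open>(x, 0)\<close> or \<open>(0, - x)\<close> with \<open>0 \<le> x \<le> h\<close>, or
  \<open>(- x, x)\<close> with \<open>1 \<le> x \<le> h\<close> (the last two values of \<open>x\<close> are omitted when \<open>n\<close> is even).
  With coordinates represented in \<open>[- h, h]\<close>, products of two elements \<open>b t\<close> give the translations: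
  the half axes fill the quadrants where both coordinates have the same sign, and a half axis
  together with the antidiagonal fills the other two. Multiplying a translation generator \<open>a\<close> by \<open>b t\<close>
  from the left or from the right gives \<open>(b + a) t\<close> or \<open>(b + a\<^sup>t) t\<close>; the \<open>a\<close> and \<open>a\<^sup>t\<close> together are all
  \<open>\<plusminus>(x, h - x)\<close> with \<open>0 \<le> x \<le> h\<close>, and their translates by the half axes meet every coset element
  (for odd \<open>n\<close> except \<open>(- x, x) t\<close> with \<open>x > 0\<close>, which are generators).
\<close>

section \<open>Cayley graphs of diameter two\<close>

lemma (in wf_digraph) unit_cost_lower_bound:
  assumes "awalk u p v" "u \<noteq> v" "\<And>e. e \<in> arcs G \<Longrightarrow> tail G e = u \<Longrightarrow> head G e \<noteq> v"
  shows "2 \<le> awalk_cost (\<lambda>_. 1) p"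
proof -
  obtain e q where p: "p = e # q"
    using assms by (cases p) (auto simp: awalk_Nil_iff)
  then obtain f q' where q: "q = f # q'"
    using assms by (cases q) (auto simp: awalk_Cons_iff awalk_Nil_iff)
  have "0 \<le> awalk_cost (\<lambda>_. 1) q'"
    unfolding awalk_cost_def by (rule sum_list_nonneg) auto
  then show ?thesis
    by (simp add: p q)
qed

text \<open>A walk from \<open>u\<close> to \<open>v\<close> spells a word for the quotient of
  \<open>v\<close> by \<open>u\<close>, so \<open>cover\<close> bounds all distances by two.
  Conversely, \<open>small\<close> leaves an element other than the identity and the generators, and
  no walk of cost below two reaches it from the identity.\<close>

lemma graph_diameter_cayley_graph_eq_2:
  assumes "group \<Gamma>" "finite (carrier \<Gamma>)" "cayley_set \<Gamma> S"
    and cover: "\<And>g. g \<in> carrier \<Gamma> \<Longrightarrow> g \<in> S \<or> (\<exists>x\<in>S. \<exists>y\<in>S. g = x \<otimes>\<^bsub>\<Gamma>\<^esub> y)"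
    and small: "card S + 1 < card (carrier \<Gamma>)"
  shows "graph_diameter (cayley_graph \<Gamma> S) = 2"
proof -
  interpret group \<Gamma> by fact
  let ?G = "with_proj (cayley_graph \<Gamma> S)"
  interpret W: wf_digraph ?G
    by unfold_locales (auto simp: cayley_graph_def)
  have verts: "verts ?G = carrier \<Gamma>"
    by (simp add: cayley_graph_def)
  have S: "S \<subseteq> carrier \<Gamma>" "\<one>\<^bsub>\<Gamma>\<^esub> \<notin> S"
    using assms(3) by (auto simp: cayley_set_def)
  have arc: "(g, g \<otimes>\<^bsub>\<Gamma>\<^esub> x) \<in> arcs ?G" if "g \<in> carrier \<Gamma>" "x \<in> S" for g x
    using that S by (auto simp: cayley_graph_def m_assoc[symmetric] subset_iff)
  have upper: "W.\<mu> (\<lambda>_. 1) u v \<le> 2" if uv: "u \<in> carrier \<Gamma>" "v \<in> carrier \<Gamma>" for u v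
  proof -
    have "\<exists>p. W.awalk u p v \<and> W.awalk_cost (\<lambda>_. 1) p \<le> 2"
    proof -
      define g where "g = inv\<^bsub>\<Gamma>\<^esub> u \<otimes>\<^bsub>\<Gamma>\<^esub> v"
      have g: "g \<in> carrier \<Gamma>" "v = u \<otimes>\<^bsub>\<Gamma>\<^esub> g"
        using uv by (auto simp: g_def m_assoc[symmetric])
      from cover[OF g(1)] show ?thesis
      proof (elim disjE bexE)
        assume "g \<in> S"
        then have "W.awalk u [(u, v)] v"
          using arc[of u g] uv g by (simp add: W.awalk_simps with_proj_simps(4,5) verts del: with_proj_simps(1,2))
        then show ?thesis
          by (intro exI[of _ "[(u, v)]"]) simp
      next
        fix x y assume xy: "x \<in> S" "y \<in> S" "g = x \<otimes>\<^bsub>\<Gamma>\<^esub> y"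
        define w where "w = u \<otimes>\<^bsub>\<Gamma>\<^esub> x"
        have w: "w \<in> carrier \<Gamma>" "v = w \<otimes>\<^bsub>\<Gamma>\<^esub> y"
          using xy uv g S by (auto simp: w_def m_assoc subset_iff)
        then have "W.awalk u [(u, w), (w, v)] v"
          using arc[of u x] arc[of w y] xy uv w_def by (simp add: W.awalk_simps with_proj_simps(4,5) verts del: with_proj_simps(1,2))
        then show ?thesis
          by (intro exI[of _ "[(u, w), (w, v)]"]) simp
      qed
    qed
    then obtain p where p: "W.awalk u p v" "W.awalk_cost (\<lambda>_. 1) p \<le> 2"
      by blast
    show ?thesis
      using W.min_cost_le_walk_cost[OF p(1), of "\<lambda>_. 1"] p(2)
      by (auto elim!: order_trans)
  qed
  have "card (insert \<one>\<^bsub>\<Gamma>\<^esub> S) < card (carrier \<Gamma>)"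
    using small S finite_subset[OF S(1) assms(2)] by simp
  then have "\<not> carrier \<Gamma> \<subseteq> insert \<one>\<^bsub>\<Gamma>\<^esub> S"
    using finite_subset[OF S(1) assms(2)] by (meson card_mono finite_insert not_less)
  then obtain g where g: "g \<in> carrier \<Gamma>" "g \<notin> S" "g \<noteq> \<one>\<^bsub>\<Gamma>\<^esub>"
    by blast
  have lower: "2 \<le> W.\<mu> (\<lambda>_. 1) \<one>\<^bsub>\<Gamma>\<^esub> g"
    unfolding W.\<mu>_def
  proof (rule INF_greatest)
    fix p assume "p \<in> {p. W.awalk \<one>\<^bsub>\<Gamma>\<^esub> p g}"
    then have "2 \<le> W.awalk_cost (\<lambda>_. 1) p"
      using g by (intro W.unit_cost_lower_bound[of "\<one>\<^bsub>\<Gamma>\<^esub>" p g]) (auto simp: cayley_graph_def)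
    then show "2 \<le> ereal (W.awalk_cost (\<lambda>_. 1) p)"
      by simp
  qed
  show ?thesis
    unfolding graph_diameter_def verts
  proof (rule antisym)
    show "(SUP u\<in>carrier \<Gamma>. SUP v\<in>carrier \<Gamma>. W.\<mu> (\<lambda>_. 1) u v) \<le> 2"
      by (intro SUP_least upper)
    show "2 \<le> (SUP u\<in>carrier \<Gamma>. SUP v\<in>carrier \<Gamma>. W.\<mu> (\<lambda>_. 1) u v)"
      by (rule SUP_upper2[OF one_closed], rule SUP_upper2[OF g(1)], rule lower)
  qed
qed

lemma (in group) image_group_inj:
  assumes "inj_on f (carrier G)"
  shows "group (image_group f G)"
    and "\<And>x y. x \<in> carrier G \<Longrightarrow> y \<in> carrier G \<Longrightarrow>
           f x \<otimes>\<^bsub>image_group f G\<^esub> f y = f (x \<otimes> y)"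
proof -
  show mult: "f x \<otimes>\<^bsub>image_group f G\<^esub> f y = f (x \<otimes> y)"
    if "x \<in> carrier G" "y \<in> carrier G" for x y
    using that assms by (simp add: image_group_def)
  show "group (image_group f G)"
  proof (rule groupI)
    fix x assume "x \<in> carrier (image_group f G)"
    then obtain a where "a \<in> carrier G" "x = f a"
      by (auto simp: image_group_carrier)
    then show "\<exists>y\<in>carrier (image_group f G). y \<otimes>\<^bsub>image_group f G\<^esub> x = \<one>\<^bsub>image_group f G\<^esub>"
      by (intro bexI[of _ "f (inv a)"]) (auto simp: mult image_group_carrier image_group_one)
  qed (auto simp: image_group_carrier image_group_one mult m_assoc)
qed

text \<open>Transport along \<open>to_nat\<close> moves the example to the carrier type
  \<open>nat\<close>. That \<open>S\<close> generates the group follows from \<open>cover\<close>.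
  Inverses are required only as right inverses inside \<open>S\<close>, which can be checked without
  computing \<open>inv\<close> in the concrete group.\<close>

lemma nat_cayley_graph_diameter_two:
  fixes G :: "('a :: countable) monoid"
  assumes "group G" "finite (carrier G)" "S \<subseteq> carrier G" "\<one>\<^bsub>G\<^esub> \<notin> S"
    and inv: "\<And>x. x \<in> S \<Longrightarrow> \<exists>y\<in>S. x \<otimes>\<^bsub>G\<^esub> y = \<one>\<^bsub>G\<^esub>"
    and cover: "\<And>g. g \<in> carrier G \<Longrightarrow> g \<in> S \<or> (\<exists>x\<in>S. \<exists>y\<in>S. g = x \<otimes>\<^bsub>G\<^esub> y)"
    and small: "card S + 1 < card (carrier G)"
  shows "\<exists>(\<Gamma> :: nat monoid) T. group \<Gamma> \<and> finite (carrier \<Gamma>) \<and> cayley_set \<Gamma> T \<and>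
           graph_diameter (cayley_graph \<Gamma> T) = 2 \<and> card T = card S \<and>
           card (carrier \<Gamma>) = card (carrier G)"
proof -
  interpret G: group G by fact
  define f :: "'a \<Rightarrow> nat" where "f = to_nat"
  have inj: "inj_on f A" for A
    by (simp add: f_def inj_on_def)
  define \<Gamma> where "\<Gamma> = image_group f G"
  define T where "T = f ` S"
  have carrier: "carrier \<Gamma> = f ` carrier G" and one: "\<one>\<^bsub>\<Gamma>\<^esub> = f \<one>\<^bsub>G\<^esub>"
    by (simp_all add: \<Gamma>_def image_group_carrier image_group_one)
  have mult: "f x \<otimes>\<^bsub>\<Gamma>\<^esub> f y = f (x \<otimes>\<^bsub>G\<^esub> y)" if "x \<in> carrier G" "y \<in> carrier G" for x y
    unfolding \<Gamma>_def using G.image_group_inj(2)[OF inj] that .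
  interpret group \<Gamma>
    unfolding \<Gamma>_def by (rule G.image_group_inj(1)[OF inj])
  have sub: "T \<subseteq> carrier \<Gamma>"
    using assms(3) by (auto simp: T_def carrier)
  have inv_T: "inv\<^bsub>\<Gamma>\<^esub> x \<in> T" if "x \<in> T" for x
  proof -
    obtain a where a: "a \<in> S" "x = f a"
      using \<open>x \<in> T\<close> by (auto simp: T_def)
    obtain b where b: "b \<in> S" "a \<otimes>\<^bsub>G\<^esub> b = \<one>\<^bsub>G\<^esub>"
      using inv[OF a(1)] by blast
    have "x \<otimes>\<^bsub>\<Gamma>\<^esub> f b = \<one>\<^bsub>\<Gamma>\<^esub>"
      using a b assms(3) mult[of a b] by (auto simp: one)
    moreover have "x \<in> carrier \<Gamma>" "f b \<in> carrier \<Gamma>"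
      using a b assms(3) by (auto simp: carrier)
    ultimately have "inv\<^bsub>\<Gamma>\<^esub> x = f b"
      by (metis inv_equality inv_inv inv_closed)
    then show ?thesis
      using b by (simp add: T_def)
  qed
  have "T = set_inv\<^bsub>\<Gamma>\<^esub> T"
  proof -
    have "x \<in> set_inv\<^bsub>\<Gamma>\<^esub> T" if "x \<in> T" for x
      using inv_T[OF that] sub that by (auto simp: SET_INV_def subset_iff intro!: bexI[of _ "inv\<^bsub>\<Gamma>\<^esub> x"])
    then show ?thesis
      using inv_T by (auto simp: SET_INV_def)
  qed
  have cover_T: "g \<in> T \<or> (\<exists>x\<in>T. \<exists>y\<in>T. g = x \<otimes>\<^bsub>\<Gamma>\<^esub> y)" if g: "g \<in> carrier \<Gamma>" for g
  proof -
    obtain a where a: "a \<in> carrier G" "g = f a"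
      using g by (auto simp: carrier)
    show ?thesis
      using cover[OF a(1)] a(2) assms(3) mult by (auto simp: T_def subset_iff)
  qed
  have "generate \<Gamma> T = carrier \<Gamma>"
  proof
    show "generate \<Gamma> T \<subseteq> carrier \<Gamma>"
      by (rule generate_incl[OF sub])
    show "carrier \<Gamma> \<subseteq> generate \<Gamma> T"
      using cover_T by (blast intro: generate.incl generate.eng)
  qed
  moreover have "\<one>\<^bsub>\<Gamma>\<^esub> \<notin> T"
    using assms(4) by (auto simp: T_def one f_def)
  ultimately have cay: "cayley_set \<Gamma> T"
    using sub \<open>T = set_inv\<^bsub>\<Gamma>\<^esub> T\<close> by (simp add: cayley_set_def)
  have fin: "finite (carrier \<Gamma>)"
    by (simp add: carrier assms(2))
  have cards: "card T = card S" "card (carrier \<Gamma>) = card (carrier G)"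
    by (simp_all add: T_def carrier card_image inj)
  have "graph_diameter (cayley_graph \<Gamma> T) = 2"
    using graph_diameter_cayley_graph_eq_2[OF group_axioms fin cay] cover_T small cards by auto
  then show ?thesis
    using group_axioms fin cay cards by blast
qed

section \<open>The wreath product of a cyclic group with a group of order two\<close>

text \<open>The triple \<open>(a, b, i)\<close> stands for the translation \<open>(a, b)\<close>,
  followed by the swap if \<open>i\<close> holds. Moving the swap past the second factor exchanges
  \<open>c\<close> and \<open>d\<close>. Reduction modulo \<open>n\<close> is postponed to
  \<open>residue\<close>, so that products can be computed with signed integers.\<close>

fun twisted_add :: "int \<times> int \<times> bool \<Rightarrow> int \<times> int \<times> bool \<Rightarrow> int \<times> int \<times> bool" where
  "twisted_add (a, b, i) (c, d, j) = (if i then (a + d, b + c, \<not> j) else (a + c, b + d, j))"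

fun residue :: "int \<Rightarrow> int \<times> int \<times> bool \<Rightarrow> int \<times> int \<times> bool" where
  "residue n (a, b, i) = (a mod n, b mod n, i)"

definition wreath :: "int \<Rightarrow> (int \<times> int \<times> bool) monoid" where
  "wreath n = \<lparr> carrier = {0..<n} \<times> {0..<n} \<times> UNIV,
     monoid.mult = (\<lambda>x y. residue n (twisted_add x y)), one = (0, 0, False) \<rparr>"

lemma residue_twisted_add:
  "residue n (twisted_add (residue n x) y) = residue n (twisted_add x y)"
  "residue n (twisted_add x (residue n y)) = residue n (twisted_add x y)"
  by (cases x; cases y; simp add: mod_simps)+

lemma residue_mult: "residue n x \<otimes>\<^bsub>wreath n\<^esub> residue n y = residue n (twisted_add x y)"
  by (simp add: wreath_def residue_twisted_add)

lemma carrier_wreath: "n > 0 \<Longrightarrow> carrier (wreath n) = range (residue n)"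
proof -
  assume n: "n > 0"
  have "x = residue n x" if "x \<in> carrier (wreath n)" for x
    using that by (cases x) (auto simp: wreath_def)
  moreover have "residue n x \<in> carrier (wreath n)" for x
    using n by (cases x) (auto simp: wreath_def)
  ultimately show ?thesis
    by blast
qed

lemma one_wreath: "\<one>\<^bsub>wreath n\<^esub> = residue n (0, 0, False)"
  by (simp add: wreath_def)

lemma residue_cong:
  assumes "n dvd a - c" "n dvd b - d"
  shows "residue n (a, b, i) = residue n (c, d, i)"
  using assms by (simp add: mod_eq_dvd_iff)

lemma group_wreath:
  assumes "n > 0"
  shows "group (wreath n)"
proof (rule groupI)
  fix x y z assume "x \<in> carrier (wreath n)" "y \<in> carrier (wreath n)" "z \<in> carrier (wreath n)"
  then obtain a b c where "x = residue n a" "y = residue n b" "z = residue n c"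
    using assms by (auto simp: carrier_wreath)
  moreover have "twisted_add (twisted_add a b) c = twisted_add a (twisted_add b c)"
    by (cases a; cases b; cases c) auto
  ultimately show "x \<otimes>\<^bsub>wreath n\<^esub> y \<otimes>\<^bsub>wreath n\<^esub> z = x \<otimes>\<^bsub>wreath n\<^esub> (y \<otimes>\<^bsub>wreath n\<^esub> z)"
    by (simp only: residue_mult)
next
  fix x assume "x \<in> carrier (wreath n)"
  then obtain a b i where x: "x = residue n (a, b, i)"
    using assms by (auto simp: carrier_wreath)
  \<comment> \<open>Passing the swap to the other side exchanges the coordinates, hence
    \<open>(- b, - a)\<close> in the reflected case.\<close>
  define y where "y = residue n (if i then (- b, - a, True) else (- a, - b, False))"
  have "y \<otimes>\<^bsub>wreath n\<^esub> x = \<one>\<^bsub>wreath n\<^esub>"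
    unfolding x y_def residue_mult one_wreath by simp
  then show "\<exists>y\<in>carrier (wreath n). y \<otimes>\<^bsub>wreath n\<^esub> x = \<one>\<^bsub>wreath n\<^esub>"
    using assms by (intro bexI[of _ y]) (auto simp: carrier_wreath y_def)
  show "\<one>\<^bsub>wreath n\<^esub> \<otimes>\<^bsub>wreath n\<^esub> x = x"
    unfolding x residue_mult one_wreath by simp
qed (use assms in \<open>auto simp: carrier_wreath residue_mult one_wreath simp del: residue.simps\<close>)

lemma card_carrier_wreath: "n > 0 \<Longrightarrow> int (card (carrier (wreath n))) = 2 * n\<^sup>2"
  by (simp add: wreath_def card_cartesian_product power2_eq_square)

section \<open>The generating set\<close>

locale generators =
  fixes r s \<epsilon> h n :: int
  assumes r: "r \<ge> 1" and s: "s = 0 \<or> s = 1" and \<epsilon>: "\<epsilon> = 0 \<or> \<epsilon> = 1"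
    and h: "h = 2 * r + s" and n: "n = 2 * h + \<epsilon>"
begin

text \<open>The lower bounds avoid repetitions: for even \<open>n\<close>, \<open>(0, - h)\<close>
  is congruent to \<open>(0, h)\<close>, hence \<open>1 - \<epsilon>\<close>; the element
  \<open>(0, 0, True)\<close> is listed only with the first half axis.\<close>

definition gens :: "(int \<times> int \<times> bool) set" where
  "gens = (\<lambda>x. (x, h - x, False)) ` {0..r} \<union> (\<lambda>x. (- x, x - h, False)) ` {1 - \<epsilon>..r} \<union>
     (\<lambda>x. (x, 0, True)) ` {0..h} \<union> (\<lambda>x. (0, - x, True)) ` {1..h} \<union>
     (\<lambda>x. (- x, x, True)) ` {1..h - 2 + 2 * \<epsilon>}"

definition S where "S = residue n ` gens"

lemma n_pos: "n > 0"
  using r s \<epsilon> h n by auto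

section \<open>The number of generators, over the integers and modulo \<open>n\<close>\<close>

lemma card_gens: "int (card gens) = 8 * r + 3 * s + 3 * \<epsilon>"
proof -
  define A A' B B' D where
    "A = (\<lambda>x. (x, h - x, False)) ` {0..r}" and "A' = (\<lambda>x. (- x, x - h, False)) ` {1 - \<epsilon>..r}" and
    "B = (\<lambda>x. (x, 0 :: int, True)) ` {0..h}" and "B' = (\<lambda>x. (0 :: int, - x, True)) ` {1..h}" and
    "D = (\<lambda>x. (- x, x, True)) ` {1..h - 2 + 2 * \<epsilon>}"
  note defs = A_def A'_def B_def B'_def D_def
  have "card A = card {0..r}" "card A' = card {1 - \<epsilon>..r}" "card B = card {0..h}" "card B' = card {1..h}"
      "card D = card {1..h - 2 + 2 * \<epsilon>}"
    unfolding defs by (intro card_image inj_onI; simp)+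
  then have cards: "int (card A) = r + 1" "int (card A') = r + \<epsilon>" "int (card B) = h + 1"
      "int (card B') = h" "int (card D) = h - 2 + 2 * \<epsilon>"
    using r s \<epsilon> h by auto
  have "A \<inter> A' = {}"
    using r h s \<epsilon> unfolding A_def A'_def by fastforce
  moreover have "(A \<union> A') \<inter> B = {}" "(A \<union> A' \<union> B) \<inter> B' = {}" "(A \<union> A' \<union> B \<union> B') \<inter> D = {}"
    unfolding defs by auto
  moreover have "finite A" "finite A'" "finite B" "finite B'" "finite D"
    unfolding defs by simp_all
  ultimately have "card gens = card A + card A' + card B + card B' + card D"
    unfolding gens_def defs[symmetric] by (simp add: card_Un_disjoint)
  then show ?thesis
    using cards h by simp
qed

lemma mem_gens:
  "(a, b, False) \<in> gens \<longleftrightarrow>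
     0 \<le> a \<and> a \<le> r \<and> b = h - a \<or> 1 - \<epsilon> \<le> - a \<and> - a \<le> r \<and> b = - a - h"
  "(a, b, True) \<in> gens \<longleftrightarrow>
     b = 0 \<and> 0 \<le> a \<and> a \<le> h \<or> a = 0 \<and> 1 \<le> - b \<and> - b \<le> h \<or> a = - b \<and> 1 \<le> b \<and> b \<le> h - 2 + 2 * \<epsilon>"
proof -
  have flip: "(\<exists>x. a = - x \<and> P x) \<longleftrightarrow> P (- a)" "(\<exists>x. b = - x \<and> P x) \<longleftrightarrow> P (- b)" for P
    by (metis minus_minus)+
  show "(a, b, False) \<in> gens \<longleftrightarrow>
     0 \<le> a \<and> a \<le> r \<and> b = h - a \<or> 1 - \<epsilon> \<le> - a \<and> - a \<le> r \<and> b = - a - h"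
    unfolding gens_def by (auto simp: image_iff Bex_def flip)
  show "(a, b, True) \<in> gens \<longleftrightarrow>
     b = 0 \<and> 0 \<le> a \<and> a \<le> h \<or> a = 0 \<and> 1 \<le> - b \<and> - b \<le> h \<or> a = - b \<and> 1 \<le> b \<and> b \<le> h - 2 + 2 * \<epsilon>"
    unfolding gens_def by (auto simp: image_iff Bex_def flip dest!: spec[of _ "- b"])
qed

text \<open>The difference is a multiple of \<open>n\<close> of absolute value at most
  \<open>2 * h = n - \<epsilon>\<close>, so it is 0 or \<open>\<plusminus>n\<close>; the latter
  forces even \<open>n\<close> and opposite ends of the interval.\<close>

lemma mod_eq_cases:
  assumes "a mod n = b mod n" "\<bar>a\<bar> \<le> h" "\<bar>b\<bar> \<le> h"
  shows "a = b \<or> \<epsilon> = 0 \<and> (a = h \<and> b = - h \<or> a = - h \<and> b = h)"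
proof -
  obtain k where k: "a - b = n * k"
    using assms(1) by (auto simp: mod_eq_dvd_iff dvd_def)
  have "\<bar>k\<bar> \<le> 1"
  proof (rule ccontr)
    assume "\<not> \<bar>k\<bar> \<le> 1"
    then have "\<bar>n * k\<bar> \<ge> n * 2"
      using n_pos by (simp add: abs_mult)
    then show False
      using k assms(2,3) n_pos n \<epsilon> by linarith
  qed
  then have "k = 0 \<or> k = 1 \<or> k = -1"
    by linarith
  then show ?thesis
    using k assms(2,3) n \<epsilon> by auto
qed

lemma gens_bounds: "(a, b, i) \<in> gens \<Longrightarrow> \<bar>a\<bar> \<le> h \<and> \<bar>b\<bar> \<le> h"
  unfolding gens_def using r s \<epsilon> h by auto

text \<open>By \<open>mod_eq_cases\<close>, a collision would need a coordinate \<open>h\<close> in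
  one generator and \<open>- h\<close> in the other, with \<open>n\<close> even. The index ranges of
  \<open>gens\<close> exclude such pairs.\<close>

lemma inj_residue: "inj_on (residue n) gens"
proof (rule inj_onI)
  fix x y assume xy: "x \<in> gens" "y \<in> gens" "residue n x = residue n y"
  obtain a b i where x: "x = (a, b, i)" by (cases x)
  obtain c d j where y: "y = (c, d, j)" by (cases y)
  have bounds: "\<bar>a\<bar> \<le> h" "\<bar>b\<bar> \<le> h" "\<bar>c\<bar> \<le> h" "\<bar>d\<bar> \<le> h"
    using xy(1,2) gens_bounds by (auto simp: x y)
  have "a mod n = c mod n" "b mod n = d mod n" and ij: "i = j"
    using xy(3) by (auto simp: x y)
  from mod_eq_cases[OF this(1)] mod_eq_cases[OF this(2)] bounds
  have "a = c \<or> \<epsilon> = 0 \<and> (a = h \<and> c = - h \<or> a = - h \<and> c = h)"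
    and "b = d \<or> \<epsilon> = 0 \<and> (b = h \<and> d = - h \<or> b = - h \<and> d = h)"
    by auto
  note wrap = this
  have g: "(a, b, j) \<in> gens" "(c, d, j) \<in> gens"
    using xy(1,2) by (simp_all add: x y ij)
  have "a = c \<and> b = d"
  proof (cases j)
    case True
    then have "(a, b, True) \<in> gens" "(c, d, True) \<in> gens"
      using g by simp_all
    then show ?thesis
      using wrap r s \<epsilon> h unfolding mem_gens by (smt (verit))
  next
    case False
    then have "(a, b, False) \<in> gens" "(c, d, False) \<in> gens"
      using g by simp_all
    then show ?thesis
      using wrap r s \<epsilon> h unfolding mem_gens by (smt (verit))
  qed
  then show "x = y"
    by (simp add: x y ij)
qed

lemma card_S: "int (card S) = 8 * r + 3 * s + 3 * \<epsilon>"
  by (simp add: S_def card_image inj_residue card_gens)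

section \<open>Products of two generators\<close>

definition covered :: "int \<times> int \<times> bool \<Rightarrow> bool" where
  "covered g \<longleftrightarrow> residue n g \<in> S \<or> (\<exists>x\<in>S. \<exists>y\<in>S. residue n g = x \<otimes>\<^bsub>wreath n\<^esub> y)"

lemma dvd_n: "a = 0 \<or> a = n \<or> a = - n \<Longrightarrow> n dvd a"
  by auto

lemma covered_cong:
  assumes "covered (a, b, i)"
    and "a - c = 0 \<or> a - c = n \<or> a - c = - n" "b - d = 0 \<or> b - d = n \<or> b - d = - n"
  shows "covered (c, d, i)"
  using assms(1) residue_cong[OF dvd_n[OF assms(2)] dvd_n[OF assms(3)], of i]
  by (simp only: covered_def)

lemma covered_S: "residue n g \<in> S \<Longrightarrow> covered g"
  by (simp add: covered_def)

lemma covered_mult: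
  "residue n x \<in> S \<Longrightarrow> residue n y \<in> S \<Longrightarrow> covered (twisted_add x y)"
  unfolding covered_def residue_mult[symmetric] by blast

lemma S_rot: "0 \<le> x \<Longrightarrow> x \<le> r \<Longrightarrow> residue n (x, h - x, False) \<in> S"
  unfolding S_def gens_def by (intro imageI) auto

text \<open>For even \<open>n\<close> the value \<open>x = 0\<close> is missing from
  \<open>gens\<close>, but there \<open>(0, - h)\<close> reduces to the same element as
  \<open>(0, h)\<close>.\<close>

lemma S_rot_neg:
  assumes "0 \<le> x" "x \<le> r"
  shows "residue n (- x, x - h, False) \<in> S"
proof (cases "1 - \<epsilon> \<le> x")
  case True
  then show ?thesis
    using assms unfolding S_def gens_def by (intro imageI) auto
next
  case False
  then have "x = 0" "\<epsilon> = 0"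
    using assms \<epsilon> by auto
  then have "residue n (- x, x - h, False) = residue n (0, h - 0, False)"
    using n by (intro residue_cong) auto
  then show ?thesis
    using S_rot[of 0] r by simp
qed

lemma S_horizontal: "0 \<le> x \<Longrightarrow> x \<le> h \<Longrightarrow> residue n (x, 0, True) \<in> S"
  unfolding S_def gens_def by (intro imageI) auto

lemma S_vertical:
  assumes "0 \<le> x" "x \<le> h"
  shows "residue n (0, - x, True) \<in> S"
proof (cases "x = 0")
  case True
  then show ?thesis
    using S_horizontal[of 0] assms by simp
next
  case False
  then show ?thesis
    using assms unfolding S_def gens_def by (intro imageI) auto
qed

lemma S_antidiagonal:
  "1 \<le> x \<Longrightarrow> x \<le> h - 2 + 2 * \<epsilon> \<Longrightarrow> residue n (- x, x, True) \<in> S"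
  unfolding S_def gens_def by (intro imageI) auto

text \<open>A translation multiplied from the left is added as it is, one multiplied from the right
  is added with swapped coordinates. For \<open>x > r\<close> the generator with parameter
  \<open>h - x\<close> is used from the right; \<open>h - x \<le> r\<close> because
  \<open>h \<le> 2 * r + 1\<close>.\<close>

lemma covered_rot:
  assumes "residue n (a, b, True) \<in> S" "0 \<le> x" "x \<le> h"
  shows "covered (a + x, b + (h - x), True)"
proof (cases "x \<le> r")
  case True
  then show ?thesis
    using covered_mult[OF S_rot[of x] assms(1)] assms by (simp add: add.commute)
next
  case False
  then have "0 \<le> h - x" "h - x \<le> r"
    using assms s h by auto
  then show ?thesis
    using covered_mult[OF assms(1) S_rot[of "h - x"]] by simp
qed

lemma covered_rot_neg:
  assumes "residue n (a, b, True) \<in> S" "0 \<le> x" "x \<le> h"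
  shows "covered (a - x, b - (h - x), True)"
proof (cases "x \<le> r")
  case True
  then show ?thesis
    using covered_mult[OF S_rot_neg[of x] assms(1)] assms by (simp add: algebra_simps)
next
  case False
  then have "0 \<le> h - x" "h - x \<le> r"
    using assms s h by auto
  then show ?thesis
    using covered_mult[OF assms(1) S_rot_neg[of "h - x"]] by (simp add: algebra_simps)
qed

text \<open>The added translation has coordinate sum \<open>h\<close> or \<open>- h\<close>, so
  \<open>p + q\<close> determines the point on the half axis, and the coordinate which that half
  axis leaves at 0 determines the translation. Where both signs are negative or positive, or
  \<open>p > 0 > q\<close>, this works over the integers; for \<open>p < 0 < q\<close> a coordinate
  is shifted by \<open>n\<close>.\<close>

lemma covered_reflection:
  assumes "\<bar>p\<bar> \<le> h" "\<bar>q\<bar> \<le> h"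
  shows "covered (p, q, True)"
proof -
  consider "p \<ge> 0" "q \<ge> 0" "p + q \<ge> h" | "p \<ge> 0" "q \<ge> 0" "p + q \<le> h"
    | "p \<le> 0" "q \<le> 0" "p + q \<ge> - h" | "p \<le> 0" "q \<le> 0" "p + q \<le> - h"
    | "p < 0" "q > 0" "p + q + \<epsilon> \<le> 0" | "p < 0" "q > 0" "p + q = 0"
    | "p < 0" "q > 0" "p + q \<ge> \<epsilon>"
    | "p > 0" "q < 0" "p + q \<le> 0" | "p > 0" "q < 0" "p + q \<ge> 0"
    using \<epsilon> by (smt (verit))
  then show ?thesis
  proof cases
    case 1
    then show ?thesis
      using covered_rot[OF S_horizontal[of "p + q - h"], of "h - q"] assms by simp
  next
    case 2
    then show ?thesis
      using covered_rot[OF S_vertical[of "h - p - q"], of p] assms by simp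
  next
    case 3
    then show ?thesis
      using covered_rot_neg[OF S_horizontal[of "h + p + q"], of "h + q"] assms by simp
  next
    case 4
    then show ?thesis
      using covered_rot_neg[OF S_vertical[of "- h - p - q"], of "- p"] assms by simp
  next
    case 5
    \<comment> \<open>This represents \<open>(p + n, q)\<close>; the half-axis parameter
      \<open>p + q + h + \<epsilon>\<close> is at most \<open>h\<close> exactly in this
      case.\<close>
    have "covered (p + q - h + n + (h - q), 0 + (h - (h - q)), True)"
      using 5 assms n \<epsilon> by (intro covered_rot S_horizontal) auto
    then show ?thesis
      by (rule covered_cong) auto
  next
    case 6
    show ?thesis
    proof (cases "\<epsilon> = 0")
      case True
      have "covered (p + q - h + n + (h - q), 0 + (h - (h - q)), True)"
        using 6 True assms n by (intro covered_rot S_horizontal) auto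
      then show ?thesis
        by (rule covered_cong) auto
    next
      case False
      \<comment> \<open>For odd \<open>n\<close> either shift would need the parameter
        \<open>h + 1\<close>, just beyond the half axis; the antidiagonal generators fill this
        gap.\<close>
      then have "residue n (- q, q, True) \<in> S"
        using 6 \<epsilon> assms by (intro S_antidiagonal) auto
      then show ?thesis
        using 6 by (intro covered_S) (metis add_eq_0_iff2)
    qed
  next
    case 7
    \<comment> \<open>This represents \<open>(p, q - n)\<close>, reached from the vertical half
      axis.\<close>
    have "covered (0 - (- p), - (n - h - p - q) - (h - (- p)), True)"
      using 7 assms n \<epsilon> by (intro covered_rot_neg S_vertical) auto
    then show ?thesis
      by (rule covered_cong) auto
  next
    case 8
    have "covered (p + q + h - (h + q), 0 - (h - (h + q)), True)"
      using 8 assms by (intro covered_rot_neg S_horizontal) auto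
    then show ?thesis
      by simp
  next
    case 9
    have "covered (0 + p, - (h - q - p) + (h - p), True)"
      using 9 assms by (intro covered_rot S_vertical) auto
    then show ?thesis
      by simp
  qed
qed

text \<open>The first factor swaps the coordinates of the second, so two elements of one half axis
  contribute to different coordinates.\<close>

lemma covered_same_sign:
  assumes "\<bar>p\<bar> \<le> h" "\<bar>q\<bar> \<le> h" "0 \<le> p \<and> 0 \<le> q \<or> p \<le> 0 \<and> q \<le> 0"
  shows "covered (p, q, False)"
  using assms(3)
proof
  assume "0 \<le> p \<and> 0 \<le> q"
  then show ?thesis
    using covered_mult[OF S_horizontal[of p] S_horizontal[of q]] assms by simp
next
  assume "p \<le> 0 \<and> q \<le> 0"
  then show ?thesis
    using covered_mult[OF S_vertical[of "- q"] S_vertical[of "- p"]] assms by simp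
qed

text \<open>
  For even \<open>n\<close> the antidiagonal stops at \<open>h - 2\<close>. It can, because \<open>2 h \<equiv> 0\<close> makes a sum of two
  translation generators reach the point \<open>\<plusminus>(h - 1, 1 - h)\<close>, and a point with a coordinate \<open>\<plusminus>h\<close> is
  congruent to one in a quadrant of equal signs.
\<close>

lemma covered_corner:
  assumes "\<epsilon> = 0"
  shows "covered (h - 1, 1 - h, False)" "covered (1 - h, h - 1, False)"
proof -
  \<comment> \<open>Both parameters lie in \<open>[0, r]\<close>, since
    \<open>h - 1 - r = r + s - 1\<close>. The second coordinate is \<open>h + 1\<close>, which is
    congruent to \<open>1 - h\<close> modulo \<open>n = 2 * h\<close>.\<close>
  have "covered (r + (h - 1 - r), (h - r) + (h - (h - 1 - r)), False)"
    using covered_mult[OF S_rot[of r] S_rot[of "h - 1 - r"]] r s h by auto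
  then show "covered (h - 1, 1 - h, False)"
    by (rule covered_cong) (use assms n in auto)
  have "covered (- r + - (h - 1 - r), (r - h) + ((h - 1 - r) - h), False)"
    using covered_mult[OF S_rot_neg[of r] S_rot_neg[of "h - 1 - r"]] r s h by auto
  then show "covered (1 - h, h - 1, False)"
    by (rule covered_cong) (use assms n in auto)
qed

text \<open>For opposite signs, the antidiagonal element takes the smaller absolute value as its
  parameter and the half axis supplies the difference; the antidiagonal factor comes first for
  \<open>p < 0\<close> and second for \<open>p > 0\<close>. This fails only if both absolute values
  exceed \<open>m\<close>, that is, for even \<open>n\<close> with both at least
  \<open>h - 1\<close>: the corner and part of the edge.\<close>

lemma covered_rotation:
  assumes "\<bar>p\<bar> \<le> h" "\<bar>q\<bar> \<le> h"
  shows "covered (p, q, False)"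
proof -
  define m where "m = h - 2 + 2 * \<epsilon>"
  have anti: "residue n (- x, x, True) \<in> S" if "1 \<le> x" "x \<le> m" for x
    using S_antidiagonal[of x] that by (simp add: m_def)
  consider (same) "0 \<le> p \<and> 0 \<le> q \<or> p \<le> 0 \<and> q \<le> 0"
    | (nw_above) "p < 0" "q > 0" "- p \<le> q" "- p \<le> m"
    | (nw_below) "p < 0" "q > 0" "q \<le> - p" "q \<le> m"
    | (se_above) "p > 0" "q < 0" "- q \<le> p" "- q \<le> m"
    | (se_below) "p > 0" "q < 0" "p \<le> - q" "p \<le> m"
    | (corner) "p = h - 1 \<and> q = 1 - h \<or> p = 1 - h \<and> q = h - 1" "\<epsilon> = 0"
    | (edge) "\<bar>p\<bar> = h \<or> \<bar>q\<bar> = h" "p * q < 0" "\<epsilon> = 0"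
  proof -
    have "p * q < 0" if "p > 0 \<and> q < 0 \<or> p < 0 \<and> q > 0"
      using that by (auto simp: mult_less_0_iff)
    then show ?thesis
      using that assms \<epsilon> m_def by (smt (verit))
  qed
  then show ?thesis
  proof cases
    case same
    then show ?thesis
      by (rule covered_same_sign[OF assms])
  next
    case nw_above
    then show ?thesis
      using covered_mult[OF anti[of "- p"] S_horizontal[of "q + p"]] assms by simp
  next
    case nw_below
    then show ?thesis
      using covered_mult[OF anti[of q] S_vertical[of "- p - q"]] assms by simp
  next
    case se_above
    then show ?thesis
      using covered_mult[OF S_horizontal[of "p + q"] anti[of "- q"]] assms by simp
  next
    case se_below
    then show ?thesis
      using covered_mult[OF S_vertical[of "- q - p"] anti[of p]] assms by simp
  next
    case corner
    then show ?thesis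
      using covered_corner by auto
  next
    case edge
    then have sgn: "p > 0 \<and> q < 0 \<or> p < 0 \<and> q > 0"
      by (auto simp: mult_less_0_iff)
    from edge(1) show ?thesis
    proof
      assume "\<bar>p\<bar> = h"
      then have "covered (- p, q, False)"
        using sgn assms by (intro covered_same_sign) auto
      then show ?thesis
        by (rule covered_cong) (use \<open>\<bar>p\<bar> = h\<close> edge(3) n in auto)
    next
      assume "\<bar>q\<bar> = h"
      then have "covered (p, - q, False)"
        using sgn assms by (intro covered_same_sign) auto
      then show ?thesis
        by (rule covered_cong) (use \<open>\<bar>q\<bar> = h\<close> edge(3) n in auto)
    qed
  qed
qed

lemma small_residue:
  obtains p where "n dvd a - p" "\<bar>p\<bar> \<le> h"
proof (cases "a mod n \<le> h")
  case True
  then show ?thesis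
    using n_pos by (intro that[of "a mod n"]) (auto simp: mod_eq_dvd_iff[symmetric])
next
  case False
  moreover have "a mod n < n"
    using n_pos by simp
  moreover have "n dvd a - (a mod n - n)"
    by (metis mod_eq_dvd_iff mod_mod_trivial minus_mod_self2)
  ultimately show ?thesis
    using n \<epsilon> by (intro that[of "a mod n - n"]) auto
qed

lemma covered_all: "covered g"
proof -
  obtain a b i where g: "g = (a, b, i)" by (cases g)
  obtain p where p: "n dvd a - p" "\<bar>p\<bar> \<le> h" by (rule small_residue)
  obtain q where q: "n dvd b - q" "\<bar>q\<bar> \<le> h" by (rule small_residue)
  have "covered (p, q, i)"
    using covered_rotation covered_reflection p q by (cases i) auto
  then show ?thesis
    using residue_cong[OF p(1) q(1), of i] by (simp only: covered_def g)
qed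

text \<open>The inverse of a reflected \<open>(a, b)\<close> is the reflected
  \<open>(- b, - a)\<close>: the two half axes are exchanged, and antidiagonal elements are
  involutions.\<close>

lemma inverse_S:
  assumes "x \<in> S"
  shows "\<exists>y\<in>S. x \<otimes>\<^bsub>wreath n\<^esub> y = \<one>\<^bsub>wreath n\<^esub>"
proof -
  have inverse: ?thesis
    if "x = residue n a" "residue n b \<in> S" "twisted_add a b = (0, 0, False)" for a b
    using that residue_mult[of n a b] one_wreath by metis
  obtain a where a: "a \<in> gens" "x = residue n a"
    using assms by (auto simp: S_def)
  from a(1) consider
      t where "a = (t, h - t, False)" "0 \<le> t" "t \<le> r"
    | t where "a = (- t, t - h, False)" "0 \<le> t" "t \<le> r"
    | t where "a = (t, 0, True)" "0 \<le> t" "t \<le> h"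
    | t where "a = (0, - t, True)" "0 \<le> t" "t \<le> h"
    | t where "a = (- t, t, True)" "1 \<le> t" "t \<le> h - 2 + 2 * \<epsilon>"
    using \<epsilon> unfolding gens_def by fastforce
  then show ?thesis
  proof cases
    case (1 t)
    then show ?thesis using inverse[OF a(2) S_rot_neg[of t]] by simp
  next
    case (2 t)
    then show ?thesis using inverse[OF a(2) S_rot[of t]] by simp
  next
    case (3 t)
    then show ?thesis using inverse[OF a(2) S_vertical[of t]] by simp
  next
    case (4 t)
    then show ?thesis using inverse[OF a(2) S_horizontal[of t]] by simp
  next
    case (5 t)
    then show ?thesis using inverse[OF a(2) S_antidiagonal[of t]] by simp
  qed
qed

lemma one_notin_S: "\<one>\<^bsub>wreath n\<^esub> \<notin> S"
proof
  assume "\<one>\<^bsub>wreath n\<^esub> \<in> S"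
  then obtain a b i where g: "(a, b, i) \<in> gens" "residue n (a, b, i) = (0, 0, False)"
    by (force simp: S_def one_wreath)
  then have mod: "a mod n = 0 mod n" "b mod n = 0 mod n" "\<not> i"
    by auto
  moreover have "\<bar>a\<bar> \<le> h" "\<bar>b\<bar> \<le> h"
    using gens_bounds[OF g(1)] by auto
  moreover have "h > 0"
    using r s h by auto
  ultimately have "a = 0" "b = 0"
    using mod_eq_cases[of a 0] mod_eq_cases[of b 0] by auto
  then have "(0, 0, False) \<in> gens"
    using g(1) mod(3) by simp
  then show False
    unfolding mem_gens using r s h \<epsilon> by auto
qed

lemma cayley_graph_exists:
  "\<exists>(\<Gamma> :: nat monoid) T. group \<Gamma> \<and> finite (carrier \<Gamma>) \<and> cayley_set \<Gamma> T \<and>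
     graph_diameter (cayley_graph \<Gamma> T) = 2 \<and> int (card T) = 8 * r + 3 * s + 3 * \<epsilon> \<and>
     int (card (carrier \<Gamma>)) = 2 * n\<^sup>2"
proof -
  \<comment> \<open>With \<open>n \<ge> 4\<close> the order \<open>2 * n * n\<close> is at least
    \<open>8 * n\<close>, while the degree is \<open>2 * n - s + \<epsilon>\<close>.\<close>
  have "n * n \<ge> 4 * n"
    using r s h n \<epsilon> by (intro mult_right_mono) auto
  then have small: "card S + 1 < card (carrier (wreath n))"
    using card_S card_carrier_wreath[OF n_pos] r s \<epsilon> h n unfolding power2_eq_square by linarith
  have cover: "g \<in> S \<or> (\<exists>x\<in>S. \<exists>y\<in>S. g = x \<otimes>\<^bsub>wreath n\<^esub> y)" if g: "g \<in> carrier (wreath n)" for g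
    using g covered_all by (auto simp: carrier_wreath[OF n_pos] covered_def simp del: residue.simps)
  have "S \<subseteq> carrier (wreath n)"
    by (auto simp: S_def carrier_wreath[OF n_pos] simp del: residue.simps)
  moreover have "finite (carrier (wreath n))"
    by (simp add: wreath_def)
  ultimately show ?thesis
    using nat_cayley_graph_diameter_two[OF group_wreath[OF n_pos] _ _ one_notin_S inverse_S cover small]
      card_S card_carrier_wreath[OF n_pos] by metis
qed

end

theorem theorem1:
  fixes r s \<epsilon> n d :: int
  assumes "r \<ge> 1"
    and "s \<in> {0, 1}"
    and "\<epsilon> \<in> {0, 1}"
    and "n = 4 * r + 2 * s + \<epsilon>"
    and "d = 2 * n - s + \<epsilon>"
  shows "\<exists>(\<Gamma> :: nat monoid) S.
           group \<Gamma> \<and> finite (carrier \<Gamma>) \<and> cayley_set \<Gamma> S \<and>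
           graph_diameter (cayley_graph \<Gamma> S) = 2 \<and>
           int (card S) = d \<and>
           real (card (pverts (cayley_graph \<Gamma> S))) = 1 / 2 * (real_of_int (d + s - \<epsilon>))\<^sup>2"
proof -
  interpret generators r s \<epsilon> "2 * r + s" n
    using assms by unfold_locales auto
  obtain \<Gamma> :: "nat monoid" and T where T: "group \<Gamma>" "finite (carrier \<Gamma>)" "cayley_set \<Gamma> T"
      "graph_diameter (cayley_graph \<Gamma> T) = 2" "int (card T) = 8 * r + 3 * s + 3 * \<epsilon>"
      "int (card (carrier \<Gamma>)) = 2 * n\<^sup>2"
    using cayley_graph_exists by blast
  have "real (card (carrier \<Gamma>)) = real_of_int (2 * n\<^sup>2)"
    using T(6) by (metis of_int_of_nat_eq)
  \<comment> \<open>Here \<open>d + s - \<epsilon> = 2 * n\<close>.\<close>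
  also have "\<dots> = 1 / 2 * (real_of_int (d + s - \<epsilon>))\<^sup>2"
    using assms(5) by (simp add: power_mult_distrib)
  finally show ?thesis
    using T assms(4,5) by (intro exI[of _ \<Gamma>] exI[of _ T]) (simp add: cayley_graph_def)
qed

end
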